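(* Let $p>0$, $Y=[0,\infty]$, and let $\circ\colon Y^2\to Y$ be a nondecreasing operator, left-continuous in the second argument, such that: (i) $x\circ(y+z)\le(x\circ y)+(x\circ z)$ for all $x,y,z\in Y$; (ii) $(ax)\circ y\le a^p(x\circ y)$ for all $x,y\in Y$ and $a>1$; (iii) if $1\circ x\le y$ for $0<y<1$, then $x\le y$. Let $(X,\mathcal{A})$ be a measurable space. If $\mu$ is a monotone measure on $\mathcal{A}$ that is subadditive and continuous from below, then $(L^p_\circ,d_{\circ,p})$ is a complete metric space.
   Context: A monotone measure is a nondecreasing set function $\mu\colon\mathcal{A}\to[0,\infty]$ with $\mu(\emptyset)=0$; it is subadditive if $\mu(A\cup B)\le\mu(A)+\mu(B)$ for all $A,B\in\mathcal{A}$, and continuous from below if $\lim_n\mu(A_n)=\mu(\bigcup_nA_n)$ for every sequence $A_n\in\mathcal{A}$ with $A_n\subset A_{n+1}$. An operator $\circ$ is nondecreasing if $a\circ b\le x\circ y$ whenever $a\le x$, $b\le y$; left-continuous in the second argument means that $y\mapsto x\circ y$ is left-continuous for each $x$. For measurable $h\colon X\to Y$, $\int_{\circ,X}h\,d\mu:=\sup_{t\in Y}\{t\circ\mu(\{h\ge t\})\}$. For measurable $f,g\colon X\to\mathbb{R}$ put $$D_{\circ,p}(f,g)=\Big(\int_{\circ,X}|f-g|^p\,d\mu\Big)^{1/(p^2+1)}.$$ $\mathcal{L}^p_\circ$ is the class of measurable $f\colon X\to\mathbb{R}$ with $D_{\circ,p}(f,0)<\infty$; $f\sim g$ means $\mu(\{|f-g|>0\})=0$;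 $L^p_\circ$ is the set of equivalence classes of $\mathcal{L}^p_\circ$ under $\sim$; and $d_{\circ,p}([f],[g])=D_{\circ,p}(f,g)$, where $[f]$ is the class of $f$.
   Formalization: The formal theorem also assumes 0∘μ(X)=0 and ∞∘0=0; without them d([f],[f])=0 fails, e.g. for x∘y=y on a one-point space with μ(X)=1. They are necessary whenever L^p is nonempty. *)

theory Defs
  imports "HOL-Analysis.Analysis"
begin

text \<open>
  The measurable space is the pair \<open>(space M, sets M)\<close>; the measure carried by \<open>M\<close> is never
  used.  The monotone measure is a separate set function \<open>\<mu>\<close>, of which only the values
  on \<open>sets M\<close> matter.
\<close>

definition monotone_measure :: "'a measure \<Rightarrow> ('a set \<Rightarrow> ennreal) \<Rightarrow> bool" where
  "monotone_measure M \<mu> \<longleftrightarrow> \<mu> {} = 0 \<and> increasing (sets M) \<mu>"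

text \<open>
  The library predicate \<^const>\<open>subadditive\<close> only constrains disjoint sets, hence a version
  for arbitrary pairs.
\<close>

definition subadditive_measure :: "'a measure \<Rightarrow> ('a set \<Rightarrow> ennreal) \<Rightarrow> bool" where
  "subadditive_measure M \<mu> \<longleftrightarrow>
     (\<forall>A\<in>sets M. \<forall>B\<in>sets M. \<mu> (A \<union> B) \<le> \<mu> A + \<mu> B)"

definition continuous_from_below :: "'a measure \<Rightarrow> ('a set \<Rightarrow> ennreal) \<Rightarrow> bool" where
  "continuous_from_below M \<mu> \<longleftrightarrow>
     (\<forall>A :: nat \<Rightarrow> 'a set. range A \<subseteq> sets M \<longrightarrow> (\<forall>n. A n \<subseteq> A (Suc n)) \<longrightarrow>
        (\<lambda>n. \<mu> (A n)) \<longlonglongrightarrow> \<mu> (\<Union>n. A n))"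

definition nondecreasing_op :: "(ennreal \<Rightarrow> ennreal \<Rightarrow> ennreal) \<Rightarrow> bool" where
  "nondecreasing_op opr \<longleftrightarrow> (\<forall>a b x y. a \<le> x \<longrightarrow> b \<le> y \<longrightarrow> opr a b \<le> opr x y)"

text \<open>
  Left-continuity is required at every point of \<open>[0,\<infinity>]\<close>, including \<open>\<infinity>\<close>; at \<open>0\<close> it is void
  because \<open>at_left 0\<close> is the trivial filter.
\<close>

definition left_continuous_snd :: "(ennreal \<Rightarrow> ennreal \<Rightarrow> ennreal) \<Rightarrow> bool" where
  "left_continuous_snd opr \<longleftrightarrow> (\<forall>x y. continuous (at_left y) (\<lambda>z. opr x z))"

definition op_integral ::
  "(ennreal \<Rightarrow> ennreal \<Rightarrow> ennreal) \<Rightarrow> 'a measure \<Rightarrow> ('a set \<Rightarrow> ennreal) \<Rightarrow> ('a \<Rightarrow> ennreal) \<Rightarrow> ennreal"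
where
  "op_integral opr M \<mu> h = (SUP t. opr t (\<mu> {x \<in> space M. h x \<ge> t}))"

text \<open>Real powers on \<open>[0,\<infinity>]\<close>, for positive exponents only (so that \<open>\<infinity>\<close> is sent to \<open>\<infinity>\<close>).\<close>

definition ennreal_rpow :: "ennreal \<Rightarrow> real \<Rightarrow> ennreal" where
  "ennreal_rpow x r = (if x = \<infinity> then \<infinity> else ennreal (enn2real x powr r))"

definition Dp ::
  "(ennreal \<Rightarrow> ennreal \<Rightarrow> ennreal) \<Rightarrow> 'a measure \<Rightarrow> ('a set \<Rightarrow> ennreal) \<Rightarrow> real \<Rightarrow>
     ('a \<Rightarrow> real) \<Rightarrow> ('a \<Rightarrow> real) \<Rightarrow> ennreal"
where
  "Dp opr M \<mu> p f g =
     ennreal_rpow (op_integral opr M \<mu> (\<lambda>x. ennreal (\<bar>f x - g x\<bar> powr p))) (1 / (p\<^sup>2 + 1))"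

definition Lp_fun ::
  "(ennreal \<Rightarrow> ennreal \<Rightarrow> ennreal) \<Rightarrow> 'a measure \<Rightarrow> ('a set \<Rightarrow> ennreal) \<Rightarrow> real \<Rightarrow> ('a \<Rightarrow> real) set"
where
  "Lp_fun opr M \<mu> p = {f \<in> borel_measurable M. Dp opr M \<mu> p f (\<lambda>_. 0) < \<infinity>}"

text \<open>
  Functions are total on the type \<open>'a\<close>; two functions that agree on \<open>space M\<close> are identified
  by the following relation (as \<open>\<mu> {} = 0\<close>), so values outside \<open>space M\<close> play no role in the quotient.
\<close>

definition Lp_rel ::
  "(ennreal \<Rightarrow> ennreal \<Rightarrow> ennreal) \<Rightarrow> 'a measure \<Rightarrow> ('a set \<Rightarrow> ennreal) \<Rightarrow> real \<Rightarrow>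
     (('a \<Rightarrow> real) \<times> ('a \<Rightarrow> real)) set"
where
  "Lp_rel opr M \<mu> p =
     {(f, g). f \<in> Lp_fun opr M \<mu> p \<and> g \<in> Lp_fun opr M \<mu> p \<and>
              \<mu> {x \<in> space M. \<bar>f x - g x\<bar> > 0} = 0}"

definition Lp_space ::
  "(ennreal \<Rightarrow> ennreal \<Rightarrow> ennreal) \<Rightarrow> 'a measure \<Rightarrow> ('a set \<Rightarrow> ennreal) \<Rightarrow> real \<Rightarrow> ('a \<Rightarrow> real) set set"
where
  "Lp_space opr M \<mu> p = Lp_fun opr M \<mu> p // Lp_rel opr M \<mu> p"

text \<open>
  The distance of two classes is computed on chosen representatives.  That it is finite and does
  not depend on the choice is not built into the definition and has to be stated as a theorem.
\<close>

definition Lp_dist ::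
  "(ennreal \<Rightarrow> ennreal \<Rightarrow> ennreal) \<Rightarrow> 'a measure \<Rightarrow> ('a set \<Rightarrow> ennreal) \<Rightarrow> real \<Rightarrow>
     ('a \<Rightarrow> real) set \<Rightarrow> ('a \<Rightarrow> real) set \<Rightarrow> real"
where
  "Lp_dist opr M \<mu> p F G = enn2real (Dp opr M \<mu> p (SOME f. f \<in> F) (SOME g. g \<in> G))"

end

theory Submission
  imports Defs
begin

text \<open>
  By the two boundary conditions only levels \<open>t = s powr p\<close> with \<open>0 < s < \<infinity>\<close> matter, and
  scaling \<open>s\<close> by \<open>b > 1\<close> costs a factor \<open>b powr p\<^sup>2\<close>; this is what the exponent
  \<open>1 / (p\<^sup>2 + 1)\<close> compensates in the triangle inequality.  By (iii), a small distance forces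
  \<open>\<mu> {\<bar>f - g\<bar> \<ge> s}\<close> to be small, so a rapidly Cauchy subsequence converges pointwise off a
  null set (Borel--Cantelli).  A Fatou lemma, resting on continuity of \<open>\<mu>\<close> from below and on
  left-continuity of the operator, turns this into convergence in the metric.
\<close>

section \<open>Comparisons in the extended half-line\<close>

text \<open>With \<open>r = p\<^sup>2 + 1\<close> this trades the outer root in \<open>Dp\<close>
  for a power of a real bound on the integral.\<close>

lemma ennreal_rpow_le_iff:
  assumes "0 < r" "0 \<le> u"
  shows "ennreal_rpow x (1 / r) \<le> ennreal u \<longleftrightarrow> x \<le> ennreal (u powr r)"
proof (cases x)
  case (real y)
  have "y powr (1 / r) \<le> u \<longleftrightarrow> y \<le> u powr r"
  proof
    assume "y powr (1 / r) \<le> u"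
    then have "(y powr (1 / r)) powr r \<le> u powr r"
      using assms by (intro powr_mono2) auto
    then show "y \<le> u powr r"
      using assms real by (simp add: powr_powr)
  next
    assume "y \<le> u powr r"
    then have "y powr (1 / r) \<le> (u powr r) powr (1 / r)"
      using assms real by (intro powr_mono2) auto
    then show "y powr (1 / r) \<le> u"
      using assms by (simp add: powr_powr)
  qed
  then show ?thesis
    using real assms by (simp add: ennreal_rpow_def)
next
  case top
  then show ?thesis
    by (simp add: ennreal_rpow_def top_unique)
qed

lemma ennreal_le_if_le_greater:
  fixes z :: ennreal
  assumes "0 \<le> d" and "\<And>u. d < u \<Longrightarrow> z \<le> ennreal u"
  shows "z \<le> ennreal d"
proof (rule ennreal_le_epsilon)
  fix e :: real
  assume "0 < e"
  then show "z \<le> ennreal d + ennreal e"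
    using assms(2)[of "d + e"] assms(1) by simp
qed

section \<open>Standing hypotheses and level sets\<close>

locale monotone_op_space =
  fixes p :: real
    and opr :: "ennreal \<Rightarrow> ennreal \<Rightarrow> ennreal"
    and M :: "'a measure"
    and \<mu> :: "'a set \<Rightarrow> ennreal"
  assumes p: "p > 0"
    and mono: "nondecreasing_op opr"
    and left_cont: "left_continuous_snd opr"
    and opr_add: "\<And>x y z. opr x (y + z) \<le> opr x y + opr x z"
    and opr_scale: "\<And>x y (a::real). a > 1 \<Longrightarrow> opr (ennreal a * x) y \<le> ennreal (a powr p) * opr x y"
    and opr_one: "\<And>x y. 0 < y \<Longrightarrow> y < 1 \<Longrightarrow> opr 1 x \<le> y \<Longrightarrow> x \<le> y"
    and measure: "monotone_measure M \<mu>"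
    and subadd: "subadditive_measure M \<mu>"
    and cont_below: "continuous_from_below M \<mu>"
    and zero_left: "opr 0 (\<mu> (space M)) = 0"
    and zero_right: "opr \<infinity> 0 = 0"
begin

text \<open>Levels are indexed by \<open>s\<close> and not by \<open>t = s powr p\<close>, so that
  the triangle inequality for absolute values splits them directly.\<close>

definition lev :: "('a \<Rightarrow> real) \<Rightarrow> ('a \<Rightarrow> real) \<Rightarrow> real \<Rightarrow> 'a set" where
  "lev f g s = {x \<in> space M. s \<le> \<bar>f x - g x\<bar>}"

abbreviation D :: "('a \<Rightarrow> real) \<Rightarrow> ('a \<Rightarrow> real) \<Rightarrow> ennreal" where
  "D \<equiv> Dp opr M \<mu> p"

lemma lev_sets [measurable]:
  "f \<in> borel_measurable M \<Longrightarrow> g \<in> borel_measurable M \<Longrightarrow> lev f g s \<in> sets M"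
  unfolding lev_def by measurable

section \<open>Set-theoretic properties of \<open>\<mu>\<close>\<close>

lemma mu_empty: "\<mu> {} = 0"
  using measure by (simp add: monotone_measure_def)

lemma mu_mono: "A \<subseteq> B \<Longrightarrow> A \<in> sets M \<Longrightarrow> B \<in> sets M \<Longrightarrow> \<mu> A \<le> \<mu> B"
  using measure by (auto simp: monotone_measure_def increasing_def)

lemma mu_Un: "A \<in> sets M \<Longrightarrow> B \<in> sets M \<Longrightarrow> \<mu> (A \<union> B) \<le> \<mu> A + \<mu> B"
  using subadd by (auto simp: subadditive_measure_def)

lemma mu_UN_incseq:
  fixes A :: "nat \<Rightarrow> 'a set"
  assumes "range A \<subseteq> sets M" "\<And>n. A n \<subseteq> A (Suc n)"
  shows "(\<lambda>n. \<mu> (A n)) \<longlonglongrightarrow> \<mu> (\<Union>n. A n)"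
  using cont_below assms by (auto simp: continuous_from_below_def)

text \<open>Finite subadditivity bounds the partial unions; these increase to the full union, so
  continuity from below carries the bound to the limit.\<close>

lemma mu_UN_le_suminf:
  fixes A :: "nat \<Rightarrow> 'a set"
  assumes A: "range A \<subseteq> sets M"
  shows "\<mu> (\<Union>n. A n) \<le> (\<Sum>n. \<mu> (A n))"
proof -
  have fin: "\<mu> (\<Union>i<n. A i) \<le> (\<Sum>i<n. \<mu> (A i))" for n
  proof (induction n)
    case 0
    then show ?case by (simp add: mu_empty)
  next
    case (Suc n)
    have "\<mu> (\<Union>i<Suc n. A i) \<le> \<mu> (\<Union>i<n. A i) + \<mu> (A n)"
      using A mu_Un[of "\<Union>i<n. A i" "A n"] by (auto simp: lessThan_Suc Un_commute)
    also have "\<dots> \<le> (\<Sum>i<Suc n. \<mu> (A i))"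
      using Suc by (simp add: add_right_mono)
    finally show ?case .
  qed
  have "(\<lambda>n. \<mu> (\<Union>i<n. A i)) \<longlonglongrightarrow> \<mu> (\<Union>n. \<Union>i<n. A i)"
    using A by (intro mu_UN_incseq) (auto simp: less_Suc_eq)
  moreover have "(\<Union>n. \<Union>i<n. A i) = (\<Union>n. A n)"
    by auto
  ultimately have lim: "(\<lambda>n. \<mu> (\<Union>i<n. A i)) \<longlonglongrightarrow> \<mu> (\<Union>n. A n)"
    by simp
  have "\<mu> (\<Union>i<n. A i) \<le> (\<Sum>n. \<mu> (A n))" for n
    using fin[of n] sum_le_suminf[of "\<lambda>n. \<mu> (A n)" "{..<n}"] by (simp add: order_trans)
  then show ?thesis
    by (intro LIMSEQ_le_const2[OF lim]) auto
qed

section \<open>The operator and bounds on the integral\<close>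

lemma opr_mono: "a \<le> x \<Longrightarrow> b \<le> y \<Longrightarrow> opr a b \<le> opr x y"
  using mono by (auto simp: nondecreasing_op_def)

text \<open>This is (ii) with factor \<open>b powr p\<close>: one exponent \<open>p\<close> comes
  from the integrand, the other from (ii), hence \<open>p\<^sup>2\<close>.\<close>

lemma opr_powr_scale:
  assumes "1 < b" "0 < s"
  shows "opr (ennreal ((b * s) powr p)) y \<le> ennreal (b powr p\<^sup>2) * opr (ennreal (s powr p)) y"
  using opr_scale[of "b powr p" "ennreal (s powr p)" y] assms p
  by (simp add: powr_mult powr_powr power2_eq_square ennreal_mult)

lemma opr_limit_le:
  fixes y :: "nat \<Rightarrow> ennreal"
  assumes "incseq y" "y \<longlonglongrightarrow> l" "\<And>n. opr x (y n) \<le> c"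
  shows "opr x l \<le> c"
\<comment> \<open>The filter \<open>at_left l\<close> excludes \<open>l\<close>, so left-continuity
  applies only to a sequence that stays strictly below its limit.\<close>
proof (cases "\<exists>n. y n = l")
  case True
  then show ?thesis using assms(3) by auto
next
  case False
  have "y n \<le> l" for n
    using assms(1,2) by (rule incseq_le)
  with False have "y n < l \<and> y n \<noteq> l" for n
    by (auto simp: less_le)
  then have "filterlim y (at_left l) sequentially"
    using assms(2) by (auto simp: filterlim_at)
  moreover have "((\<lambda>z. opr x z) \<longlongrightarrow> opr x l) (at_left l)"
    using left_cont by (auto simp: left_continuous_snd_def continuous_within)
  ultimately have "(\<lambda>n. opr x (y n)) \<longlonglongrightarrow> opr x l"
    by (rule filterlim_compose[rotated])
  then show ?thesis
    using assms(3) by (intro LIMSEQ_le_const2) auto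
qed

lemma op_integral_le_iff:
  "op_integral opr M \<mu> (\<lambda>x. ennreal (\<bar>f x - g x\<bar> powr p)) \<le> c
     \<longleftrightarrow> (\<forall>s>0. opr (ennreal (s powr p)) (\<mu> (lev f g s)) \<le> c)"
  (is "?I \<le> c \<longleftrightarrow> ?R")
proof -
  let ?L = "\<lambda>t. {x \<in> space M. ennreal (\<bar>f x - g x\<bar> powr p) \<ge> t}"
  have lev: "?L (ennreal (s powr p)) = lev f g s" if "0 < s" for s
  proof -
    have "s powr p \<le> w powr p \<longleftrightarrow> s \<le> w" if "0 \<le> w" for w
      using that \<open>0 < s\<close> p powr_less_mono2[of p w s] powr_mono2[of p s w] by force
    then show ?thesis
      by (auto simp: lev_def)
  qed
  have "?I \<le> c \<longleftrightarrow> (\<forall>t. opr t (\<mu> (?L t)) \<le> c)"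
    unfolding op_integral_def SUP_le_iff by simp
  also have "\<dots> \<longleftrightarrow> ?R"
  proof
    assume "\<forall>t. opr t (\<mu> (?L t)) \<le> c"
    then show ?R
      using lev by metis
  next
    assume R: ?R
    show "\<forall>t. opr t (\<mu> (?L t)) \<le> c"
    proof
      fix t :: ennreal
      consider "t = 0" | "t = \<infinity>" | r where "t = ennreal r" "0 < r"
        by (cases t) (auto simp: less_le)
      then show "opr t (\<mu> (?L t)) \<le> c"
      proof cases
        \<comment> \<open>The level set at 0 is all of \<open>space M\<close>.\<close>
        case 1
        then show ?thesis using zero_left by simp
      next
        \<comment> \<open>The integrand is finite everywhere, so the level set at
          \<open>\<infinity>\<close> is empty.\<close>
        case 2
        then show ?thesis using zero_right mu_empty by (simp add: top_unique)
      next
        case 3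
        define s where "s = r powr (1 / p)"
        have "t = ennreal (s powr p)" "0 < s"
          using 3 p by (auto simp: s_def powr_powr)
        then show ?thesis
          using R lev[of s] by (simp del: ennreal_le_iff)
      qed
    qed
  qed
  finally show ?thesis .
qed

text \<open>The working form of \<open>D\<close>: the estimates below argue level by level and leave
  the supremum and the root folded.\<close>

lemma D_le_iff:
  assumes "0 \<le> u"
  shows "D f g \<le> ennreal u
     \<longleftrightarrow> (\<forall>s>0. opr (ennreal (s powr p)) (\<mu> (lev f g s)) \<le> ennreal (u powr (p\<^sup>2 + 1)))"
  unfolding Dp_def
  by (subst ennreal_rpow_le_iff) (simp_all add: assms op_integral_le_iff add_nonneg_pos)

section \<open>Symmetry and the triangle inequality\<close>

lemma D_commute: "D f g = D g f"
  by (simp add: Dp_def abs_minus_commute)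

text \<open>
  The levels of the two summands are split in the ratio \<open>u : v\<close>.  This minimises the
  resulting bound, and the minimum is the exact power \<open>(u + v) powr (p\<^sup>2 + 1)\<close>.
\<close>

lemma D_triangle_real:
  assumes [measurable]: "f \<in> borel_measurable M" "g \<in> borel_measurable M" "h \<in> borel_measurable M"
    and u: "0 < u" "D f g \<le> ennreal u" and v: "0 < v" "D g h \<le> ennreal v"
  shows "D f h \<le> ennreal (u + v)"
proof -
  define a b where "a = (u + v) / u" and "b = (u + v) / v"
  have ab: "1 < a" "1 < b"
    using u(1) v(1) by (auto simp: a_def b_def)
  \<comment> \<open>One estimate serves both summands, with \<open>w\<close> equal to
    \<open>u\<close> or \<open>v\<close>. Raising the level from \<open>s / c\<close> to
    \<open>s\<close> costs \<open>c powr p\<^sup>2\<close>, which cancels all but one factor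
    \<open>w\<close> of \<open>w powr (p\<^sup>2 + 1)\<close>.\<close>
  have part: "opr (ennreal (s powr p)) (\<mu> (lev f' g' (s / ((u + v) / w))))
      \<le> ennreal (w * (u + v) powr p\<^sup>2)"
    if "0 < s" "0 < w" "w < u + v" "D f' g' \<le> ennreal w" for s w f' g'
  proof -
    define c where "c = (u + v) / w"
    have c: "1 < c" using that by (simp add: c_def)
    have "opr (ennreal (s powr p)) (\<mu> (lev f' g' (s / c)))
        \<le> ennreal (c powr p\<^sup>2) * opr (ennreal ((s / c) powr p)) (\<mu> (lev f' g' (s / c)))"
      using opr_powr_scale[of c "s / c"] c that by simp
    also have "\<dots> \<le> ennreal (c powr p\<^sup>2) * ennreal (w powr (p\<^sup>2 + 1))"
      using that c by (intro mult_left_mono) (auto simp: D_le_iff)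
    also have "\<dots> = ennreal (w * (u + v) powr p\<^sup>2)"
      using that by (simp add: c_def powr_divide powr_add mult.commute flip: ennreal_mult)
    finally show ?thesis by (simp add: c_def)
  qed
  have "opr (ennreal (s powr p)) (\<mu> (lev f h s)) \<le> ennreal ((u + v) powr (p\<^sup>2 + 1))"
    if s: "0 < s" for s
  proof -
    have split: "s / a + s / b = s"
      using u(1) v(1) by (simp add: a_def b_def flip: add_divide_distrib distrib_left)
    have "lev f h s \<subseteq> lev f g (s / a) \<union> lev g h (s / b)"
    proof
      fix x
      assume x: "x \<in> lev f h s"
      then have "s / a + s / b \<le> \<bar>f x - g x\<bar> + \<bar>g x - h x\<bar>"
        using split by (auto simp: lev_def)
      then show "x \<in> lev f g (s / a) \<union> lev g h (s / b)"
        using x by (auto simp: lev_def)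
    qed
    then have "\<mu> (lev f h s) \<le> \<mu> (lev f g (s / a)) + \<mu> (lev g h (s / b))"
      by (intro order_trans[OF mu_mono mu_Un]) auto
    then have "opr (ennreal (s powr p)) (\<mu> (lev f h s))
        \<le> opr (ennreal (s powr p)) (\<mu> (lev f g (s / a)))
          + opr (ennreal (s powr p)) (\<mu> (lev g h (s / b)))"
      by (intro order_trans[OF opr_mono opr_add]) auto
    also have "\<dots> \<le> ennreal (u * (u + v) powr p\<^sup>2) + ennreal (v * (u + v) powr p\<^sup>2)"
      unfolding a_def b_def using s u v by (intro add_mono part) auto
    also have "\<dots> = ennreal ((u + v) powr (p\<^sup>2 + 1))"
      using u(1) v(1) by (simp add: powr_add algebra_simps flip: ennreal_plus)
    finally show ?thesis .
  qed
  then show ?thesis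
    using u(1) v(1) by (subst D_le_iff) auto
qed

text \<open>The splitting ratio needs positive bounds, whereas a distance may be 0; each distance is
  therefore enlarged by half of the gap between their sum and an arbitrary larger
  \<open>w\<close>.\<close>

lemma D_triangle:
  assumes "f \<in> borel_measurable M" "g \<in> borel_measurable M" "h \<in> borel_measurable M"
  shows "D f h \<le> D f g + D g h"
proof (cases "D f g = \<infinity> \<or> D g h = \<infinity>")
  case True
  then show ?thesis by auto
next
  case False
  then obtain a b where ab: "D f g = ennreal a" "0 \<le> a" "D g h = ennreal b" "0 \<le> b"
    by (cases "D f g"; cases "D g h") auto
  have "D f h \<le> ennreal (a + b)"
  proof (rule ennreal_le_if_le_greater)
    fix w assume w: "a + b < w"
    define e where "e = (w - (a + b)) / 2"
    have e: "0 < e"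
      using w by (simp add: e_def)
    have "D f h \<le> ennreal ((a + e) + (b + e))"
      using assms ab e by (intro D_triangle_real[of f g h]) (auto intro: ennreal_leI)
    also have "(a + e) + (b + e) = w"
      unfolding e_def by (simp add: field_simps)
    finally show "D f h \<le> ennreal w" .
  qed (use ab in simp)
  then show ?thesis
    using ab by simp
qed

section \<open>Small distances and null sets\<close>

text \<open>\<open>D\<close> dominates the Ky Fan distance of convergence in measure.\<close>

lemma mu_lev_le:
  assumes "0 < d" "d < 1" "D f g \<le> ennreal d"
  shows "\<mu> (lev f g d) \<le> ennreal d"
proof (rule opr_one)
  \<comment> \<open>The factor \<open>1 / d\<close> lifts level \<open>d\<close> to level 1, where
    (iii) applies; its cost \<open>(1 / d) powr p\<^sup>2\<close> reduces the bound
    \<open>d powr (p\<^sup>2 + 1)\<close> to exactly \<open>d\<close>.\<close>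
  have "opr (ennreal ((1 / d * d) powr p)) (\<mu> (lev f g d))
      \<le> ennreal ((1 / d) powr p\<^sup>2) * opr (ennreal (d powr p)) (\<mu> (lev f g d))"
    using assms by (intro opr_powr_scale) auto
  also have "\<dots> \<le> ennreal ((1 / d) powr p\<^sup>2) * ennreal (d powr (p\<^sup>2 + 1))"
    using assms by (intro mult_left_mono) (auto simp: D_le_iff)
  also have "\<dots> = ennreal d"
    using assms by (simp add: powr_divide powr_add flip: ennreal_mult)
  finally show "opr 1 (\<mu> (lev f g d)) \<le> ennreal d"
    using assms by simp
qed (use assms in auto)

text \<open>Forward, \<open>mu_lev_le\<close> at arbitrarily small \<open>d\<close> makes every
  positive level null, and continuity from below handles their union. Backward, each level has
  measure 0 and \<open>opr \<infinity> 0 = 0\<close> dominates its contribution.\<close>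

lemma D_eq_0_iff:
  assumes [measurable]: "f \<in> borel_measurable M" "g \<in> borel_measurable M"
  shows "D f g = 0 \<longleftrightarrow> \<mu> {x \<in> space M. \<bar>f x - g x\<bar> > 0} = 0"
proof
  assume D0: "D f g = 0"
  have lev0: "\<mu> (lev f g s) = 0" if "0 < s" for s
  proof -
    have "\<mu> (lev f g s) \<le> ennreal 0"
    proof (rule ennreal_le_epsilon)
      fix e :: real
      assume "0 < e"
      \<comment> \<open>At most \<open>s\<close> for monotonicity of the levels, at most
        \<open>e\<close> for the bound, and at most \<open>1 / 2\<close> because
        \<open>mu_lev_le\<close> requires \<open>d < 1\<close>.\<close>
      define d where "d = min (min s e) (1 / 2)"
      have d: "0 < d" "d < 1" "d \<le> s" "d \<le> e"
        using that \<open>0 < e\<close> by (auto simp: d_def)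
      have "\<mu> (lev f g s) \<le> \<mu> (lev f g d)"
        using d by (intro mu_mono) (auto simp: lev_def)
      also have "\<dots> \<le> ennreal d"
        using d D0 by (intro mu_lev_le) auto
      also have "\<dots> \<le> ennreal 0 + ennreal e"
        using d by (simp add: ennreal_leI)
      finally show "\<mu> (lev f g s) \<le> ennreal 0 + ennreal e" .
    qed
    then show ?thesis by simp
  qed
  have "(\<lambda>n. \<mu> (lev f g (inverse (real (Suc n))))) \<longlonglongrightarrow> \<mu> (\<Union>n. lev f g (inverse (real (Suc n))))"
  proof (rule mu_UN_incseq)
    show "lev f g (inverse (real (Suc n))) \<subseteq> lev f g (inverse (real (Suc (Suc n))))" for n
    proof -
      have le: "inverse (real (Suc (Suc n))) \<le> inverse (real (Suc n))"
        by (intro le_imp_inverse_le) auto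
      show ?thesis
        using le order_trans unfolding lev_def by blast
    qed
  qed auto
  moreover have "\<mu> (lev f g (inverse (real (Suc n)))) = 0" for n
    by (rule lev0) simp
  ultimately have "\<mu> (\<Union>n. lev f g (inverse (real (Suc n)))) = 0"
    by (simp only: tendsto_const_iff LIMSEQ_const_iff)
  moreover have "(\<Union>n. lev f g (inverse (real (Suc n)))) = {x \<in> space M. \<bar>f x - g x\<bar> > 0}"
  proof (intro equalityI subsetI)
    fix x
    assume "x \<in> (\<Union>n. lev f g (inverse (real (Suc n))))"
    then obtain n where n: "x \<in> space M" "inverse (real (Suc n)) \<le> \<bar>f x - g x\<bar>"
      by (auto simp: lev_def)
    moreover have "0 < inverse (real (Suc n))"
      by simp
    ultimately show "x \<in> {x \<in> space M. \<bar>f x - g x\<bar> > 0}"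
      by (auto simp del: of_nat_Suc)
  next
    fix x
    assume x: "x \<in> {x \<in> space M. \<bar>f x - g x\<bar> > 0}"
    then obtain n where "inverse (real (Suc n)) < \<bar>f x - g x\<bar>"
      using reals_Archimedean by blast
    then have "x \<in> lev f g (inverse (real (Suc n)))"
      using x by (simp add: lev_def)
    then show "x \<in> (\<Union>n. lev f g (inverse (real (Suc n))))"
      by blast
  qed
  ultimately show "\<mu> {x \<in> space M. \<bar>f x - g x\<bar> > 0} = 0"
    by simp
next
  assume N: "\<mu> {x \<in> space M. \<bar>f x - g x\<bar> > 0} = 0"
  have "opr (ennreal (s powr p)) (\<mu> (lev f g s)) \<le> 0" if "0 < s" for s
  proof -
    have "\<mu> (lev f g s) \<le> \<mu> {x \<in> space M. \<bar>f x - g x\<bar> > 0}"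
      using that by (intro mu_mono) (auto simp: lev_def)
    with N have "opr (ennreal (s powr p)) (\<mu> (lev f g s)) \<le> opr \<infinity> 0"
      by (intro opr_mono) auto
    then show ?thesis using zero_right by simp
  qed
  then have "D f g \<le> ennreal 0"
    by (subst D_le_iff) auto
  then show "D f g = 0" by simp
qed

section \<open>Fatou lemma\<close>

text \<open>Off \<open>B\<close>, a point of level \<open>s\<close> for the limit eventually lies in
  level \<open>s / b\<close> of the sequence, for any \<open>b > 1\<close>. The bound survives the
  increasing limit of these sets, and returning to level \<open>s\<close> costs a factor that tends
  to 1 with \<open>b\<close>.\<close>

lemma D_Fatou:
  fixes F :: "nat \<Rightarrow> 'a \<Rightarrow> real"
  assumes F [measurable]: "\<And>n. F n \<in> borel_measurable M"
    and [measurable]: "f \<in> borel_measurable M" "g \<in> borel_measurable M"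
    and B: "B \<in> sets M" "\<mu> B = 0"
    and lim: "\<And>x. x \<in> space M - B \<Longrightarrow> (\<lambda>n. F n x) \<longlonglongrightarrow> f x"
    and u: "0 \<le> u" and bound: "\<And>n. n \<ge> N \<Longrightarrow> D g (F n) \<le> ennreal u"
  shows "D g f \<le> ennreal u"
proof -
  have "opr (ennreal (s powr p)) (\<mu> (lev g f s)) \<le> ennreal (u powr (p\<^sup>2 + 1))"
    if s: "0 < s" for s
  proof -
    have "opr (ennreal (s powr p)) (\<mu> (lev g f s)) \<le> ennreal (b powr p\<^sup>2 * u powr (p\<^sup>2 + 1))"
      if b: "1 < b" for b
    proof -
      \<comment> \<open>Points in level \<open>s / b\<close> from some index on: the sets grow with
        \<open>n\<close>, and starting at \<open>max N n\<close> keeps \<open>bound\<close>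
        applicable.\<close>
      define C where "C n = (\<Inter>k\<in>{max N n..}. lev g (F k) (s / b))" for n
      have C [measurable]: "C n \<in> sets M" for n
        unfolding C_def by (intro sets.countable_INT') auto
      have C_mono: "C m \<subseteq> C n" if "m \<le> n" for m n
        using that by (auto simp: C_def)
      have limC: "(\<lambda>n. \<mu> (C n)) \<longlonglongrightarrow> \<mu> (\<Union>n. C n)"
        by (intro mu_UN_incseq C_mono) auto
      have "opr (ennreal ((s / b) powr p)) (\<mu> (C n)) \<le> ennreal (u powr (p\<^sup>2 + 1))" for n
      proof -
        have "\<mu> (C n) \<le> \<mu> (lev g (F (max N n)) (s / b))"
          by (intro mu_mono) (auto simp: C_def)
        then have "opr (ennreal ((s / b) powr p)) (\<mu> (C n))
            \<le> opr (ennreal ((s / b) powr p)) (\<mu> (lev g (F (max N n)) (s / b)))"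
          by (intro opr_mono) auto
        also have "\<dots> \<le> ennreal (u powr (p\<^sup>2 + 1))"
          using bound[of "max N n"] s b u by (auto simp: D_le_iff)
        finally show ?thesis .
      qed
      then have UC: "opr (ennreal ((s / b) powr p)) (\<mu> (\<Union>n. C n)) \<le> ennreal (u powr (p\<^sup>2 + 1))"
        by (intro opr_limit_le[OF _ limC]) (auto simp: incseq_def intro!: mu_mono C_mono)
      have "lev g f s \<subseteq> (\<Union>n. C n) \<union> B"
      proof
        fix x
        assume x: "x \<in> lev g f s"
        show "x \<in> (\<Union>n. C n) \<union> B"
        proof (cases "x \<in> B")
          case False
          with x have "(\<lambda>n. F n x) \<longlonglongrightarrow> f x"
            by (intro lim) (auto simp: lev_def)
          then have "(\<lambda>n. \<bar>g x - F n x\<bar>) \<longlonglongrightarrow> \<bar>g x - f x\<bar>"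
            by (intro tendsto_intros)
          \<comment> \<open>Strictness is the reason for lowering the level:
            \<open>s \<le> \<bar>g x - f x\<bar>\<close> alone would not pass to the terms of the
            sequence.\<close>
          moreover have "s / b < \<bar>g x - f x\<bar>"
          proof -
            have "s / b < s"
              using s b by (simp add: field_simps)
            then show ?thesis
              using x by (auto simp: lev_def)
          qed
          ultimately have "\<forall>\<^sub>F n in sequentially. s / b < \<bar>g x - F n x\<bar>"
            by (rule order_tendstoD)
          then obtain n where "\<And>k. k \<ge> n \<Longrightarrow> s / b < \<bar>g x - F k x\<bar>"
            by (auto simp: eventually_sequentially)
          then have "x \<in> C n"
            using x by (auto simp: C_def lev_def less_imp_le)
          then show ?thesis by auto
        qed simp
      qed
      then have "\<mu> (lev g f s) \<le> \<mu> (\<Union>n. C n) + \<mu> B"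
        using B by (intro order_trans[OF mu_mono mu_Un]) auto
      then have "opr (ennreal (s powr p)) (\<mu> (lev g f s)) \<le> opr (ennreal (s powr p)) (\<mu> (\<Union>n. C n))"
        using B by (intro opr_mono) auto
      also have "\<dots> \<le> ennreal (b powr p\<^sup>2) * opr (ennreal ((s / b) powr p)) (\<mu> (\<Union>n. C n))"
        using opr_powr_scale[of b "s / b"] b s by simp
      also have "\<dots> \<le> ennreal (b powr p\<^sup>2) * ennreal (u powr (p\<^sup>2 + 1))"
        by (intro mult_left_mono UC) auto
      finally show ?thesis
        by (simp add: ennreal_mult)
    qed
    \<comment> \<open>The left-hand side does not depend on \<open>b\<close>, so \<open>b\<close>
      may decrease to 1.\<close>
    then have "\<forall>\<^sub>F b in at_right (1::real). opr (ennreal (s powr p)) (\<mu> (lev g f s))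
        \<le> ennreal (b powr p\<^sup>2 * u powr (p\<^sup>2 + 1))"
      by (simp add: eventually_at_filter)
    moreover have "((\<lambda>b. ennreal (b powr p\<^sup>2 * u powr (p\<^sup>2 + 1)))
        \<longlongrightarrow> ennreal (1 powr p\<^sup>2 * u powr (p\<^sup>2 + 1))) (at_right (1::real))"
      by (intro tendsto_ennrealI tendsto_intros) auto
    ultimately have "opr (ennreal (s powr p)) (\<mu> (lev g f s))
        \<le> ennreal (1 powr p\<^sup>2 * u powr (p\<^sup>2 + 1))"
      by (intro tendsto_lowerbound[where F = "at_right (1::real)"]) auto
    then show ?thesis by simp
  qed
  then show ?thesis
    using u by (subst D_le_iff) auto
qed

section \<open>Pointwise convergence off a null set\<close>

text \<open>Borel--Cantelli: \<open>mu_lev_le\<close> makes the measures of the exceptional sets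
  summable, and outside their limit superior the increments are eventually dominated by a geometric
  series.\<close>

lemma convergent_off_null_set:
  fixes F :: "nat \<Rightarrow> 'a \<Rightarrow> real"
  assumes F [measurable]: "\<And>n. F n \<in> borel_measurable M"
    and DF: "\<And>n. D (F n) (F (Suc n)) \<le> ennreal ((1 / 2) ^ Suc n)"
  shows "\<exists>B\<in>sets M. \<mu> B = 0 \<and> (\<forall>x\<in>space M - B. convergent (\<lambda>n. F n x))"
proof -
  \<comment> \<open>The exponent \<open>Suc n\<close> keeps the threshold below 1 even at
    \<open>n = 0\<close>, as \<open>mu_lev_le\<close> requires, and makes the tail from
    \<open>k\<close> sum to \<open>(1 / 2) ^ k\<close>.\<close>
  define A where "A n = lev (F n) (F (Suc n)) ((1 / 2) ^ Suc n)" for n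
  define B where "B = (\<Inter>k. \<Union>n. A (n + k))"
  have A [measurable]: "A n \<in> sets M" for n
    by (simp add: A_def)
  have BM: "B \<in> sets M"
    unfolding B_def by measurable
  have muA: "\<mu> (A n) \<le> ennreal ((1 / 2) ^ Suc n)" for n
    unfolding A_def using DF[of n] by (intro mu_lev_le) (auto intro: power_Suc_less_one simp del: power_Suc)
  have muB: "\<mu> B \<le> ennreal ((1 / 2) ^ k)" for k
  proof -
    have "\<mu> B \<le> \<mu> (\<Union>n. A (n + k))"
      using BM by (intro mu_mono) (auto simp: B_def)
    also have "\<dots> \<le> (\<Sum>n. \<mu> (A (n + k)))"
      by (intro mu_UN_le_suminf) auto
    also have "\<dots> \<le> (\<Sum>n. ennreal ((1 / 2) ^ Suc (n + k)))"
      by (intro suminf_le muA) auto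
    also have "\<dots> = ennreal ((1 / 2) ^ k)"
    proof (rule suminf_ennreal_eq)
      show "(\<lambda>n. (1 / 2) ^ Suc (n + k)) sums ((1 / 2) ^ k :: real)"
        using sums_mult[OF power_half_series, of "(1 / 2) ^ k"]
        by (simp add: power_add mult_ac)
    qed auto
    finally show ?thesis .
  qed
  have "\<mu> B \<le> ennreal 0"
  proof (rule ennreal_le_if_le_greater)
    fix e :: real
    assume "0 < e"
    then obtain k where "(1 / 2) ^ k < e"
      using real_arch_pow_inv[of e "1 / 2"] by auto
    then show "\<mu> B \<le> ennreal e"
      using muB[of k] by (meson ennreal_leI less_imp_le order_trans)
  qed simp
  then have B0: "\<mu> B = 0" by simp
  have "convergent (\<lambda>n. F n x)" if x: "x \<in> space M - B" for x
  proof -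
    obtain k where k: "x \<notin> A (n + k)" for n
      using x by (auto simp: B_def)
    have "summable (\<lambda>n. F (Suc n) x - F n x)"
    proof (rule summable_comparison_test)
      show "\<exists>N. \<forall>n\<ge>N. norm (F (Suc n) x - F n x) \<le> (1 / 2) ^ Suc n"
      proof (intro exI[of _ k] allI impI)
        fix n
        assume "k \<le> n"
        then have "x \<notin> A n"
          using k[of "n - k"] by simp
        then show "norm (F (Suc n) x - F n x) \<le> (1 / 2) ^ Suc n"
          using x by (auto simp: A_def lev_def abs_minus_commute)
      qed
      show "summable (\<lambda>n. (1 / 2) ^ Suc n :: real)"
        using power_half_series by (rule sums_summable)
    qed
    then show ?thesis
      by (simp add: summable_iff_convergent sum_lessThan_telescope[of "\<lambda>n. F n x"] convergent_diff_const_right_iff)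
  qed
  then show ?thesis
    using BM B0 by auto
qed

section \<open>The quotient and its metric\<close>

abbreviation "Lf \<equiv> Lp_fun opr M \<mu> p"
abbreviation "Lr \<equiv> Lp_rel opr M \<mu> p"
abbreviation "Ls \<equiv> Lp_space opr M \<mu> p"
abbreviation "Ld \<equiv> Lp_dist opr M \<mu> p"

lemma Lp_fun_measurable: "f \<in> Lf \<Longrightarrow> f \<in> borel_measurable M"
  by (simp add: Lp_fun_def)

lemma Lp_fun_triangle: "f \<in> Lf \<Longrightarrow> g \<in> Lf \<Longrightarrow> h \<in> Lf \<Longrightarrow> D f h \<le> D f g + D g h"
  by (intro D_triangle Lp_fun_measurable)

lemma Lp_fun_finite:
  assumes "f \<in> Lf" "g \<in> Lf"
  shows "D f g < \<infinity>"
proof -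
  have "D f g \<le> D f (\<lambda>_. 0) + D g (\<lambda>_. 0)"
    using D_triangle[of f "\<lambda>_. 0" g] assms
    by (simp add: Lp_fun_measurable D_commute[of "\<lambda>_. 0" g])
  also have "\<dots> < \<infinity>"
    using assms by (simp add: Lp_fun_def)
  finally show ?thesis .
qed

text \<open>Turns almost-everywhere equality into zero distance, so that transitivity and
  independence of representatives follow from the triangle inequality.\<close>

lemma Lp_rel_iff: "(f, g) \<in> Lr \<longleftrightarrow> f \<in> Lf \<and> g \<in> Lf \<and> D f g = 0"
  by (auto simp: Lp_rel_def D_eq_0_iff Lp_fun_measurable)

lemma D_refl: "D f f = 0"
  using D_le_iff[of 0 f f] mu_empty zero_right opr_mono[OF top_greatest order_refl, of _ 0]
  by (auto simp: lev_def top_unique)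

lemma equiv_Lp_rel: "equiv Lf Lr"
proof (rule equivI)
  show "trans Lr"
  proof (rule transI)
    fix f g h
    assume "(f, g) \<in> Lr" "(g, h) \<in> Lr"
    then show "(f, h) \<in> Lr"
      using Lp_fun_triangle[of f g h] by (auto simp: Lp_rel_iff)
  qed
qed (auto simp: Lp_rel_iff D_refl D_commute refl_on_def intro!: symI)

lemma D_cong:
  assumes "(f, f') \<in> Lr" "(g, g') \<in> Lr"
  shows "D f' g' = D f g"
proof -
  \<comment> \<open>One inequality suffices: the relation is symmetric, so the reversed pairs give
    the other.\<close>
  have *: "D f' g' \<le> D f g" if "(f, f') \<in> Lr" "(g, g') \<in> Lr" for f f' g g'
  proof -
    have "D f' g' \<le> D f' f + (D f g + D g g')"
      using that Lp_fun_triangle[of f' f g'] Lp_fun_triangle[of f g g']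
      by (auto simp: Lp_rel_iff intro: order_trans add_left_mono)
    then show ?thesis
      using that by (simp add: Lp_rel_iff D_commute[of f' f])
  qed
  have "(f', f) \<in> Lr" "(g', g) \<in> Lr"
    using assms by (auto simp: Lp_rel_iff D_commute)
  then show ?thesis
    using * assms by (blast intro: antisym)
qed

text \<open>\<open>D_cong\<close> removes the choice of representatives, and finiteness of
  \<open>D\<close> makes \<open>enn2real\<close> lossless; later arguments can thus work with
  \<open>D\<close> on functions.\<close>

lemma Lp_dist_class:
  assumes "f \<in> Lf" "g \<in> Lf"
  shows "ennreal (Ld (Lr `` {f}) (Lr `` {g})) = D f g"
proof -
  have rep: "(h, SOME h'. h' \<in> Lr `` {h}) \<in> Lr" if "h \<in> Lf" for h
    using someI[of "\<lambda>h'. h' \<in> Lr `` {h}" h] that D_refl by (auto simp: Lp_rel_iff)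
  have "D (SOME f'. f' \<in> Lr `` {f}) (SOME g'. g' \<in> Lr `` {g}) = D f g"
    using assms by (intro D_cong rep)
  then show ?thesis
    using Lp_fun_finite[OF assms] by (simp add: Lp_dist_def)
qed

lemma Lp_space_rep: "F \<in> Ls \<Longrightarrow> \<exists>f\<in>Lf. F = Lr `` {f}"
  by (auto simp: Lp_space_def elim: quotientE)

lemma Lp_dist_nonneg: "0 \<le> Ld F G"
  by (simp add: Lp_dist_def)

lemma Metric_space_Lp: "Metric_space Ls Ld"
proof
  fix F G H
  show "0 \<le> Ld F G" by (rule Lp_dist_nonneg)
  show "Ld F G = Ld G F"
    by (simp add: Lp_dist_def D_commute)
  show "Ld F G = 0 \<longleftrightarrow> F = G" if FG: "F \<in> Ls" "G \<in> Ls"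
  proof -
    obtain f g where fg: "f \<in> Lf" "g \<in> Lf" "F = Lr `` {f}" "G = Lr `` {g}"
      using FG Lp_space_rep by blast
    have "Ld F G = 0 \<longleftrightarrow> ennreal (Ld F G) = 0"
      using Lp_dist_nonneg[of F G] by auto
    also have "\<dots> \<longleftrightarrow> (f, g) \<in> Lr"
      using fg by (simp add: Lp_dist_class Lp_rel_iff)
    also have "\<dots> \<longleftrightarrow> F = G"
      using fg eq_equiv_class_iff[OF equiv_Lp_rel] by blast
    finally show ?thesis .
  qed
  show "Ld F H \<le> Ld F G + Ld G H" if FGH: "F \<in> Ls" "G \<in> Ls" "H \<in> Ls"
  proof -
    obtain f g h where fgh: "f \<in> Lf" "g \<in> Lf" "h \<in> Lf"
      "F = Lr `` {f}" "G = Lr `` {g}" "H = Lr `` {h}"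
      using FGH Lp_space_rep by metis
    have "ennreal (Ld F H) \<le> ennreal (Ld F G) + ennreal (Ld G H)"
      using fgh Lp_fun_triangle by (simp add: Lp_dist_class)
    then show ?thesis
      using Lp_dist_nonneg by (simp flip: ennreal_plus)
  qed
qed

section \<open>Completeness\<close>

lemma mcomplete_Lp: "Metric_space.mcomplete Ls Ld"
proof -
  interpret Metric_space Ls Ld by (rule Metric_space_Lp)
  show ?thesis
    unfolding mcomplete_def
  proof (intro allI impI)
    fix S
    assume S: "MCauchy S"
    have "\<forall>n. \<exists>f\<in>Lf. S n = Lr `` {f}"
      using S by (intro allI Lp_space_rep) (auto simp: MCauchy_def)
    then obtain F where F: "\<And>n. F n \<in> Lf" "\<And>n. S n = Lr `` {F n}"
      by metis
    have cauchy: "\<exists>N. \<forall>m\<ge>N. \<forall>n\<ge>N. D (F m) (F n) \<le> ennreal e" if "0 < e" for e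
    proof -
      obtain N where N: "\<forall>m n. N \<le> m \<longrightarrow> N \<le> n \<longrightarrow> Ld (S m) (S n) < e"
        using S \<open>0 < e\<close> unfolding MCauchy_def by blast
      have "D (F m) (F n) \<le> ennreal e" if "N \<le> m" "N \<le> n" for m n
      proof -
        have "Ld (S m) (S n) \<le> e"
          using N that by (intro less_imp_le) blast
        then have "ennreal (Ld (S m) (S n)) \<le> ennreal e"
          by (rule ennreal_leI)
        then show ?thesis
          by (simp only: F Lp_dist_class)
      qed
      then show ?thesis
        by blast
    qed
    have "\<exists>N. \<forall>m\<ge>N. \<forall>n\<ge>N. D (F m) (F n) \<le> ennreal ((1 / 2) ^ Suc k)" for k
      by (rule cauchy) simp
    then obtain N where "\<forall>k. \<forall>m\<ge>N k. \<forall>n\<ge>N k. D (F m) (F n) \<le> ennreal ((1 / 2) ^ Suc k)"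
      by metis
    then have N: "D (F m) (F n) \<le> ennreal ((1 / 2) ^ Suc k)" if "N k \<le> m" "N k \<le> n" for k m n
      using that by blast
    \<comment> \<open>The maximum puts both \<open>r k\<close> and \<open>r (Suc k)\<close> beyond
      \<open>N k\<close>, so consecutive terms are close; the summand \<open>k\<close> gives
      \<open>k \<le> r k\<close>.\<close>
    define r where "r k = k + Max (N ` {..k})" for k
    have r_N: "N j \<le> r k" if "j \<le> k" for j k
      unfolding r_def using that by (intro trans_le_add2 Max_ge) auto
    have r_ge: "k \<le> r k" for k
      by (simp add: r_def)
    define G where "G k = F (r k)" for k
    have G [measurable]: "G k \<in> borel_measurable M" for k
      using F(1) by (simp add: G_def Lp_fun_measurable)
    have "D (G k) (G (Suc k)) \<le> ennreal ((1 / 2) ^ Suc k)" for k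
      unfolding G_def by (intro N r_N) auto
    then obtain B where B: "B \<in> sets M" "\<mu> B = 0"
      "\<And>x. x \<in> space M - B \<Longrightarrow> convergent (\<lambda>k. G k x)"
      using convergent_off_null_set[of G] G by blast
    \<comment> \<open>On \<open>B\<close> the sequence may diverge and \<open>lim\<close> is then
      unspecified; \<open>f\<close> is measurable all the same, and \<open>B\<close> is
      null.\<close>
    define f where "f x = lim (\<lambda>k. G k x)" for x
    have fM [measurable]: "f \<in> borel_measurable M"
      unfolding f_def by measurable
    have conv: "\<exists>N. \<forall>n\<ge>N. D (F n) f \<le> ennreal e" if e: "0 < e" for e
    proof -
      obtain K where K: "\<And>m n. K \<le> m \<Longrightarrow> K \<le> n \<Longrightarrow> D (F m) (F n) \<le> ennreal e"
        using cauchy[OF e] by blast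
      \<comment> \<open>Fatou along the subsequence with \<open>n\<close> fixed: the Cauchy bound
        between \<open>F n\<close> and \<open>G k\<close> yields convergence of the whole
        sequence.\<close>
      have "D (F n) f \<le> ennreal e" if "K \<le> n" for n
      proof (rule D_Fatou[OF G fM])
        show "F n \<in> borel_measurable M"
          using F by (simp add: Lp_fun_measurable)
        show "(\<lambda>k. G k x) \<longlonglongrightarrow> f x" if "x \<in> space M - B" for x
          using B(3)[OF that] by (simp add: f_def convergent_LIMSEQ_iff)
        show "D (F n) (G k) \<le> ennreal e" if "K \<le> k" for k
          unfolding G_def using K \<open>K \<le> n\<close> that r_ge[of k] by simp
      qed (use B e in auto)
      then show ?thesis by blast
    qed
    have "f \<in> Lf"
    proof -
      obtain n where n: "D (F n) f \<le> ennreal 1"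
        using conv[of 1] by auto
      have "D f (\<lambda>_. 0) \<le> D (F n) f + D (F n) (\<lambda>_. 0)"
        using D_triangle[of f "F n" "\<lambda>_. 0"] F(1)[of n]
        by (simp add: Lp_fun_measurable D_commute[of f])
      also have "\<dots> < \<infinity>"
        using le_less_trans[OF n ennreal_less_top] F(1)[of n] by (simp add: Lp_fun_def)
      finally show ?thesis
        using fM by (simp add: Lp_fun_def)
    qed
    have "limitin mtopology S (Lr `` {f}) sequentially"
      unfolding limit_metric_sequentially
    proof (intro conjI allI impI)
      show "Lr `` {f} \<in> Ls"
        using \<open>f \<in> Lf\<close> by (auto simp: Lp_space_def intro: quotientI)
      fix e :: real
      assume "0 < e"
      \<comment> \<open>Halving \<open>e\<close> turns the weak inequality for \<open>D\<close> into
        the strict one that the metric limit demands.\<close>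
      then obtain N where "\<And>n. N \<le> n \<Longrightarrow> D (F n) f \<le> ennreal (e / 2)"
        using conv[of "e / 2"] by auto
      then have "ennreal (Ld (S n) (Lr `` {f})) \<le> ennreal (e / 2)" if "N \<le> n" for n
        using that by (simp only: F \<open>f \<in> Lf\<close> Lp_dist_class)
      then have "Ld (S n) (Lr `` {f}) < e" if "N \<le> n" for n
        using that \<open>0 < e\<close> by fastforce
      moreover have "S n \<in> Ls" for n
        using S by (auto simp: MCauchy_def)
      ultimately show "\<exists>N. \<forall>n\<ge>N. S n \<in> Ls \<and> Ld (S n) (Lr `` {f}) < e"
        by blast
    qed
    then show "\<exists>x. limitin mtopology S x sequentially"
      by blast
  qed
qed

end

theorem theorem6:
  fixes p :: real
    and opr :: "ennreal \<Rightarrow> ennreal \<Rightarrow> ennreal"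
    and M :: "'a measure"
    and \<mu> :: "'a set \<Rightarrow> ennreal"
  assumes p: "p > 0"
    and mono: "nondecreasing_op opr"
    and left_cont: "left_continuous_snd opr"
    and i: "\<And>x y z. opr x (y + z) \<le> opr x y + opr x z"
    and ii: "\<And>x y (a::real). a > 1 \<Longrightarrow> opr (ennreal a * x) y \<le> ennreal (a powr p) * opr x y"
    and iii: "\<And>x y. 0 < y \<Longrightarrow> y < 1 \<Longrightarrow> opr 1 x \<le> y \<Longrightarrow> x \<le> y"
    and measure: "monotone_measure M \<mu>"
    and subadd: "subadditive_measure M \<mu>"
    and cont_below: "continuous_from_below M \<mu>"
    (* Implicit boundary conditions: the integral of the zero function is
       max (opr 0 (\<mu> (space M))) (opr \<infinity> 0), so without them d([f],[f]) = 0 fails. *)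
    and zero_left: "opr 0 (\<mu> (space M)) = 0"
    and zero_right: "opr \<infinity> 0 = 0"
  shows "equiv (Lp_fun opr M \<mu> p) (Lp_rel opr M \<mu> p)
    \<and> (\<forall>f\<in>Lp_fun opr M \<mu> p. \<forall>g\<in>Lp_fun opr M \<mu> p.
          ennreal (Lp_dist opr M \<mu> p (Lp_rel opr M \<mu> p `` {f}) (Lp_rel opr M \<mu> p `` {g}))
            = Dp opr M \<mu> p f g)
    \<and> Metric_space (Lp_space opr M \<mu> p) (Lp_dist opr M \<mu> p)
    \<and> Metric_space.mcomplete (Lp_space opr M \<mu> p) (Lp_dist opr M \<mu> p)"
proof -
  interpret monotone_op_space p opr M \<mu>
    by unfold_locales (fact assms)+
  show ?thesis
    using equiv_Lp_rel Lp_dist_class Metric_space_Lp mcomplete_Lp by blast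
qed

end
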